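(* For every $k\in\mathbb{N}$ there is a constant $c(k)>0$, depending only on $k$, such that the following holds. Let $G$ be a connected graph, and suppose that the cycle space $\mathcal{C}(G)$ is generated by cycles of length at most $k$. Then either $G$ is quasi-isometric to a tree, or for every $r \in \mathbb{N}$ there is a vertex $v$ of $G$ such that $|B_v(r)| \geq c(k)\, r^2$.
   Context: The edge space of a graph $G=(V,E)$ is the vector space $\mathbb{F}_2^E$ over the 2-element field (addition is symmetric difference of edge sets). The cycle space $\mathcal{C}(G)$ is the subspace of the edge space generated by the edge-sets of (finite) cycles; equivalently, the first simplicial homology group of $G$ over $\mathbb{Z}_2$. The graph distance $d(x,y)$ is the minimum number of edges in an $x$–$y$ path. $B_v(r)$ is the set of vertices at graph distance at most $r$ from $v$. A quasi-isometry between graphs $G=(V,E)$ and $H=(V',E')$ is a map $f:V\to V'$ such that for some constants $M\ge 1$, $A\ge 0$: (1) $M^{-1}d(x,y)-A\le d(f(x),f(y))\le M d(x,y)+A$ for all $x,y\in V$; and (2) for every $z\in V'$ there is $x\in V$ with $d(z,f(x))\le A$. Two graphs are quasi-isometric if such a map exists. A tree is a connected acyclic graph (finite or infinite). *)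

theory Defs
  imports Complex_Main "HOL-Library.Z2" "HOL-Library.Function_Algebras"
    "HOL-Library.Indicator_Function"
begin

text \<open>
  Graphs are simple and of arbitrary cardinality, given by a vertex set \<open>V\<close> and a
  set \<open>E\<close> of two-element subsets of \<open>V\<close>.
\<close>

definition simple_graph :: "'a set \<Rightarrow> 'a set set \<Rightarrow> bool" where
  "simple_graph V E \<longleftrightarrow> (\<forall>e\<in>E. \<exists>x\<in>V. \<exists>y\<in>V. x \<noteq> y \<and> e = {x, y})"

text \<open>A path is the list of its vertices, so it has \<open>length xs - 1\<close> edges.\<close>

definition graph_path :: "'a set \<Rightarrow> 'a set set \<Rightarrow> 'a \<Rightarrow> 'a list \<Rightarrow> 'a \<Rightarrow> bool" where
  "graph_path V E x xs y \<longleftrightarrow>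
     xs \<noteq> [] \<and> hd xs = x \<and> last xs = y \<and> distinct xs \<and> set xs \<subseteq> V \<and>
     successively (\<lambda>u v. {u, v} \<in> E) xs"

text \<open>Connected graphs are nonempty.\<close>

definition connected_graph :: "'a set \<Rightarrow> 'a set set \<Rightarrow> bool" where
  "connected_graph V E \<longleftrightarrow>
     simple_graph V E \<and> V \<noteq> {} \<and> (\<forall>x\<in>V. \<forall>y\<in>V. \<exists>xs. graph_path V E x xs y)"

text \<open>Only meaningful if \<open>x\<close> and \<open>y\<close> are joined by a path, e.g. in a connected graph.\<close>

definition graph_dist :: "'a set \<Rightarrow> 'a set set \<Rightarrow> 'a \<Rightarrow> 'a \<Rightarrow> nat" where
  "graph_dist V E x y = (LEAST n. \<exists>xs. graph_path V E x xs y \<and> length xs = Suc n)"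

definition graph_ball :: "'a set \<Rightarrow> 'a set set \<Rightarrow> 'a \<Rightarrow> nat \<Rightarrow> 'a set" where
  "graph_ball V E v r = {x\<in>V. graph_dist V E v x \<le> r}"

text \<open>
  A cycle is the list of its vertices in cyclic order, without repeating the first one;
  its length is the length of the list.
\<close>

definition cycle_edges :: "'a list \<Rightarrow> 'a set set" where
  "cycle_edges xs = {{xs ! i, xs ! (Suc i mod length xs)} | i. i < length xs}"

definition graph_cycle :: "'a set \<Rightarrow> 'a set set \<Rightarrow> 'a list \<Rightarrow> bool" where
  "graph_cycle V E xs \<longleftrightarrow>
     3 \<le> length xs \<and> distinct xs \<and> set xs \<subseteq> V \<and> cycle_edges xs \<subseteq> E"

definition is_tree :: "'a set \<Rightarrow> 'a set set \<Rightarrow> bool" where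
  "is_tree V E \<longleftrightarrow> connected_graph V E \<and> (\<nexists>xs. graph_cycle V E xs)"

text \<open>
  The edge space consists of the functions \<open>'a set \<Rightarrow> bit\<close> vanishing outside \<open>E\<close>. The
  spans below are taken in the space of all functions \<open>'a set \<Rightarrow> bit\<close>, which makes no
  difference, as the generators vanish outside \<open>E\<close>.
\<close>

interpretation edge_space: vector_space "\<lambda>(c::bit) (f::'a set \<Rightarrow> bit) e. c * f e"
  by unfold_locales
    (simp_all only: fun_eq_iff plus_fun_def distrib_left distrib_right mult.assoc mult_1_left simp_thms)

definition cycle_space :: "'a set \<Rightarrow> 'a set set \<Rightarrow> ('a set \<Rightarrow> bit) set" where
  "cycle_space V E = edge_space.span {indicator (cycle_edges C) | C. graph_cycle V E C}"

definition cycle_space_generated_upto :: "nat \<Rightarrow> 'a set \<Rightarrow> 'a set set \<Rightarrow> bool" where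
  "cycle_space_generated_upto k V E \<longleftrightarrow>
     cycle_space V E =
       edge_space.span {indicator (cycle_edges C) | C. graph_cycle V E C \<and> length C \<le> k}"

definition quasi_isometry ::
  "'a set \<Rightarrow> 'a set set \<Rightarrow> 'b set \<Rightarrow> 'b set set \<Rightarrow> ('a \<Rightarrow> 'b) \<Rightarrow> bool" where
  "quasi_isometry V E V' E' f \<longleftrightarrow>
     f ` V \<subseteq> V' \<and>
     (\<exists>M A :: real. M \<ge> 1 \<and> A \<ge> 0 \<and>
        (\<forall>x\<in>V. \<forall>y\<in>V.
           inverse M * real (graph_dist V E x y) - A \<le> real (graph_dist V' E' (f x) (f y)) \<and>
           real (graph_dist V' E' (f x) (f y)) \<le> M * real (graph_dist V E x y) + A) \<and>
        (\<forall>z\<in>V'. \<exists>x\<in>V. real (graph_dist V' E' z (f x)) \<le> A))"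

definition quasi_isometric :: "'a set \<Rightarrow> 'a set set \<Rightarrow> 'b set \<Rightarrow> 'b set set \<Rightarrow> bool" where
  "quasi_isometric V E V' E' \<longleftrightarrow> (\<exists>f. quasi_isometry V E V' E' f)"

text \<open>
  The tree may be sought on the vertex type of the graph without loss of generality: if
  \<open>V\<close> is finite, a single vertex will do, and if \<open>V\<close> is infinite and \<open>f\<close> is a
  quasi-isometry from \<open>V\<close> to some tree, then the subtree spanned by \<open>f ` V\<close> has
  cardinality at most \<open>|V|\<close> and is still quasi-isometric to \<open>V\<close>.
\<close>

definition quasi_isometric_to_tree :: "'a set \<Rightarrow> 'a set set \<Rightarrow> bool" where
  "quasi_isometric_to_tree V E \<longleftrightarrow>
     (\<exists>(T :: 'a set) F. is_tree T F \<and> quasi_isometric V E T F)"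

text \<open>Infinite balls count as large; \<open>card\<close> is \<open>0\<close> on them.\<close>

definition quadratic_balls :: "real \<Rightarrow> 'a set \<Rightarrow> 'a set set \<Rightarrow> bool" where
  "quadratic_balls c V E \<longleftrightarrow>
     (\<forall>r::nat. \<exists>v\<in>V. infinite (graph_ball V E v r) \<or>
                     real (card (graph_ball V E v r)) \<ge> c * (real r)\<^sup>2)"

text \<open>
  The constant \<open>c(k)\<close>. A constant that is bound by an existential quantifier inside a
  theorem about graphs on a type \<open>'a\<close> could depend on \<open>'a\<close>. To have one constant for
  the graphs on all types, it is chosen here as one that serves the graphs on \<open>nat\<close>, if
  there is any. Such a constant serves all graphs: a connected graph that violates the
  bound on the balls for some \<open>r\<close> has \<open>r \<ge> 1\<close> and finite degrees, hence is countable and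
  isomorphic to a graph on \<open>nat\<close>.
\<close>

definition growth_const :: "nat \<Rightarrow> real" where
  "growth_const k =
     (SOME c. c > 0 \<and>
        (\<forall>(V :: nat set) E. connected_graph V E \<longrightarrow> cycle_space_generated_upto k V E \<longrightarrow>
           quasi_isometric_to_tree V E \<or> quadratic_balls c V E))"

end

(* Fix a root, and let the clusters be the classes of vertices at the same distance n from the
   root that are joined by a walk outside the ball of radius n - 1 around it. The clusters form a
   tree, and if their diameters are bounded, then G is quasi-isometric to that tree.

   Otherwise, let m be the midpoint of a geodesic between two far apart vertices x, y of one
   cluster. Either the walk from x to y through the higher levels or the one through the root
   avoids the ball of radius r around m. For s <= r let a, b be the points of the geodesic at
   distance s from m. If the component K of a in the annulus of radii s and s + k around m did not
   contain b, then the set L of edges between K and the ball of radius s - 1 would meet every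
   cycle of length at most k in an even number of edges, hence every cycle, while the geodesic
   and the avoiding walk yield a cycle with a single edge in L. So the annulus connects a to b and
   has at least 2 s + 1 vertices. Summing over disjoint annuli gives the quadratic bound. *)

theory Submission
  imports Defs "HOL-Library.Countable_Set"
begin

section \<open>Paths and distances\<close>

text \<open>A relation, so that walks of length n are relational powers, reachability is a reflexive
  transitive closure, and \<open>Restr\<close> confines walks to a vertex set.\<close>

definition adj :: "'a set set \<Rightarrow> ('a \<times> 'a) set" where
  "adj E = {(u, v). {u, v} \<in> E}"

lemma adj_iff: "(u, v) \<in> adj E \<longleftrightarrow> {u, v} \<in> E"
  by (simp add: adj_def)

lemma adj_sym: "(u, v) \<in> adj E \<Longrightarrow> (v, u) \<in> adj E"
  by (simp add: adj_def insert_commute)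

text \<open>If the next vertex of the walk already occurs, the list is cut off at that occurrence.
  The start is inserted into the bound because it need not lie in the range of
  \<open>R\<close>.\<close>

lemma relpow_imp_distinct_list:
  assumes "(x, y) \<in> R ^^ n"
  shows "\<exists>xs. xs \<noteq> [] \<and> hd xs = x \<and> last xs = y \<and> distinct xs \<and>
    set xs \<subseteq> insert x (Range R) \<and> successively (\<lambda>u v. (u, v) \<in> R) xs \<and> length xs \<le> Suc n"
  using assms
proof (induction n arbitrary: y)
  case 0
  then show ?case by (intro exI[of _ "[x]"]) auto
next
  case (Suc n)
  then obtain w where w: "(x, w) \<in> R ^^ n" "(w, y) \<in> R" by auto
  from Suc.IH[OF w(1)] obtain xs where xs: "xs \<noteq> []" "hd xs = x" "last xs = w" "distinct xs"
    "set xs \<subseteq> insert x (Range R)" "successively (\<lambda>u v. (u, v) \<in> R) xs" "length xs \<le> Suc n"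
    by blast
  show ?case
  proof (cases "y \<in> set xs")
    case True
    then obtain ys zs where eq: "xs = (ys @ [y]) @ zs" using split_list by fastforce
    then have "successively (\<lambda>u v. (u, v) \<in> R) (ys @ [y])"
      using xs(6) unfolding eq successively_append_iff by blast
    with xs eq show ?thesis
      by (intro exI[of _ "ys @ [y]"]) (cases ys; simp)
  next
    case False
    with xs w show ?thesis
      by (intro exI[of _ "xs @ [y]"]) (auto simp: successively_append_iff)
  qed
qed

lemma successively_imp_relpow:
  assumes "xs \<noteq> []" "successively (\<lambda>u v. (u, v) \<in> R) xs"
  shows "(hd xs, last xs) \<in> R ^^ (length xs - 1)"
  using assms
proof (induction xs rule: rev_induct)
  case (snoc a xs)
  show ?case
  proof (cases "xs = []")
    case False
    then have "(hd xs, last xs) \<in> R ^^ (length xs - 1)" "(last xs, a) \<in> R"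
      using snoc by (auto simp: successively_append_iff)
    then have "(hd xs, a) \<in> R ^^ Suc (length xs - 1)" by auto
    with False show ?thesis by simp
  qed simp
qed simp

lemma simple_graph_edgeD:
  assumes "simple_graph V E" "(u, v) \<in> adj E"
  shows "u \<in> V" "v \<in> V" "u \<noteq> v"
  using assms unfolding simple_graph_def adj_def by (auto simp: doubleton_eq_iff)

lemma relpow_imp_graph_path:
  assumes "simple_graph V E" "x \<in> V" "(x, y) \<in> adj E ^^ n"
  shows "\<exists>xs. graph_path V E x xs y \<and> length xs \<le> Suc n"
proof -
  have "Range (adj E) \<subseteq> V" using simple_graph_edgeD[OF assms(1)] by auto
  then have "insert x (Range (adj E)) \<subseteq> V" using assms(2) by blast
  moreover obtain xs where "xs \<noteq> []" "hd xs = x" "last xs = y" "distinct xs"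
    "set xs \<subseteq> insert x (Range (adj E))" "successively (\<lambda>u v. (u, v) \<in> adj E) xs" "length xs \<le> Suc n"
    using relpow_imp_distinct_list[OF assms(3)] by blast
  ultimately have "graph_path V E x xs y \<and> length xs \<le> Suc n"
    unfolding graph_path_def by (simp add: adj_iff subset_trans)
  then show ?thesis ..
qed

lemma graph_path_imp_relpow:
  assumes "graph_path V E x xs y"
  shows "(x, y) \<in> adj E ^^ (length xs - 1)"
  using assms successively_imp_relpow[of xs "adj E"] unfolding graph_path_def by (auto simp: adj_iff)

lemma graph_dist_le_relpow:
  assumes "simple_graph V E" "x \<in> V" "(x, y) \<in> adj E ^^ n"
  shows "graph_dist V E x y \<le> n"
proof -
  from relpow_imp_graph_path[OF assms] obtain xs
    where xs: "graph_path V E x xs y" "length xs \<le> Suc n" by blast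
  then have "length xs = Suc (length xs - 1)" by (auto simp: graph_path_def)
  with xs(1) have "graph_dist V E x y \<le> length xs - 1"
    unfolding graph_dist_def by (intro Least_le) auto
  with xs(2) show ?thesis by simp
qed

lemma connected_graphI:
  assumes "simple_graph V E" "V \<noteq> {}" "\<And>x y. x \<in> V \<Longrightarrow> y \<in> V \<Longrightarrow> (x, y) \<in> (adj E)\<^sup>*"
  shows "connected_graph V E"
  unfolding connected_graph_def
  using assms relpow_imp_graph_path[OF assms(1)] by (metis rtrancl_imp_relpow)

locale conn_graph =
  fixes V :: "'a set" and E
  assumes connected: "connected_graph V E"
begin

abbreviation d where "d \<equiv> graph_dist V E"

lemma simple: "simple_graph V E"
  using connected by (simp add: connected_graph_def)

lemmas adjD = simple_graph_edgeD[OF simple]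
lemmas d_le_relpow = graph_dist_le_relpow[OF simple]

lemma relpow_d:
  assumes "x \<in> V" "y \<in> V"
  shows "(x, y) \<in> adj E ^^ d x y"
proof -
  from assms connected obtain xs where xs: "graph_path V E x xs y"
    by (auto simp: connected_graph_def)
  then have "length xs = Suc (length xs - 1)" by (auto simp: graph_path_def)
  with xs have "\<exists>n xs. graph_path V E x xs y \<and> length xs = Suc n" by blast
  then have "\<exists>xs. graph_path V E x xs y \<and> length xs = Suc (d x y)"
    unfolding graph_dist_def by (rule LeastI_ex)
  then show ?thesis using graph_path_imp_relpow by fastforce
qed

lemma relpow_adj_sym: "(x, y) \<in> adj E ^^ n \<Longrightarrow> (y, x) \<in> adj E ^^ n"
proof (induction n arbitrary: y)
  case (Suc n)
  then obtain w where "(x, w) \<in> adj E ^^ n" "(w, y) \<in> adj E" by auto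
  then show ?case using Suc.IH adj_sym relpow_Suc_I2 by metis
qed auto

lemma d_self [simp]: "x \<in> V \<Longrightarrow> d x x = 0"
  using d_le_relpow[of x x 0] by simp

lemma d_commute: "x \<in> V \<Longrightarrow> y \<in> V \<Longrightarrow> d x y = d y x"
  using relpow_d relpow_adj_sym d_le_relpow by (meson antisym)

lemma d_triangle: "x \<in> V \<Longrightarrow> y \<in> V \<Longrightarrow> z \<in> V \<Longrightarrow> d x z \<le> d x y + d y z"
  using relpow_d[of x y] relpow_d[of y z] by (intro d_le_relpow) (auto simp: relpow_add)

lemma d_adj: "(x, y) \<in> adj E \<Longrightarrow> d x y \<le> 1"
  using d_le_relpow[of x y 1] adjD by auto

lemma d_step:
  assumes "z \<in> V" "(x, y) \<in> adj E"
  shows "d z y \<le> Suc (d z x)" "d z x \<le> Suc (d z y)"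
  using d_triangle[of z x y] d_triangle[of z y x] d_adj[OF assms(2)] d_adj[OF adj_sym[OF assms(2)]]
    assms adjD[OF assms(2)] by auto

lemma obtain_geodesic:
  assumes "x \<in> V" "y \<in> V"
  obtains g where "g 0 = x" "g (d x y) = y" "\<And>i. i < d x y \<Longrightarrow> (g i, g (Suc i)) \<in> adj E"
    "\<And>i. i \<le> d x y \<Longrightarrow> g i \<in> V"
    "\<And>i j. i \<le> j \<Longrightarrow> j \<le> d x y \<Longrightarrow> d (g i) (g j) = j - i"
proof -
  from relpow_d[OF assms] obtain g where g: "g 0 = x" "g (d x y) = y"
    and step: "\<And>i. i < d x y \<Longrightarrow> (g i, g (Suc i)) \<in> adj E"
    by (auto simp: relpow_fun_conv)
  have V: "g i \<in> V" if "i \<le> d x y" for i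
    using that step[of "i - 1"] adjD g(1) assms by (cases i) auto
  have le: "d (g i) (g (i + n)) \<le> n" if "i + n \<le> d x y" for i n
    using that
  proof (induction n)
    case (Suc n)
    then show ?case using d_step(1)[OF V[of i] step[of "i + n"]] by simp
  qed (use V in auto)
  \<comment> \<open>A shortcut between two points would make the whole walk shorter than
    \<open>d x y\<close>.\<close>
  have eq: "d (g i) (g j) = j - i" if "i \<le> j" "j \<le> d x y" for i j
  proof -
    have "d (g 0) (g (d x y)) \<le> d (g 0) (g i) + (d (g i) (g j) + d (g j) (g (d x y)))"
      using d_triangle[of "g 0" "g i" "g (d x y)"] d_triangle[of "g i" "g j" "g (d x y)"] that V
      by force
    moreover have "d (g 0) (g i) \<le> i" using le[of 0 i] that by simp
    moreover have "d (g j) (g (d x y)) \<le> d x y - j" using le[of j "d x y - j"] that by simp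
    moreover have "d (g i) (g j) \<le> j - i" using le[of i "j - i"] that by simp
    ultimately show ?thesis using g that by simp
  qed
  show ?thesis using that[OF g step V eq] by blast
qed

end

section \<open>Parity of edge cuts on cycles\<close>

lemma cycle_edges_eq_image:
  "cycle_edges xs = (\<lambda>i. {xs ! i, xs ! (Suc i mod length xs)}) ` {..<length xs}"
  by (auto simp: cycle_edges_def)

lemma sum_cycle_edges:
  assumes "distinct xs" "3 \<le> length xs"
  shows "(\<Sum>e\<in>cycle_edges xs. l e) = (\<Sum>i<length xs. l {xs ! i, xs ! (Suc i mod length xs)})"
proof -
  let ?n = "length xs"
  have "inj_on (\<lambda>i. {xs ! i, xs ! (Suc i mod ?n)}) {..<?n}"
  proof (rule inj_onI)
    fix i j assume ij: "i \<in> {..<?n}" "j \<in> {..<?n}"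
      and eq: "{xs ! i, xs ! (Suc i mod ?n)} = {xs ! j, xs ! (Suc j mod ?n)}"
    have lt: "l mod ?n < ?n" for l using assms by (intro mod_less_divisor) linarith
    show "i = j"
    proof (rule ccontr)
      assume "i \<noteq> j"
      then have "xs ! i \<noteq> xs ! j" using assms ij by (simp add: nth_eq_iff_index_eq)
      then have "xs ! i = xs ! (Suc j mod ?n)" "xs ! (Suc i mod ?n) = xs ! j"
        using eq by (auto simp: doubleton_eq_iff)
      then have "i = Suc j mod ?n" "Suc i mod ?n = j"
        using assms ij lt by (auto simp: nth_eq_iff_index_eq)
      \<comment> \<open>Two indices that are cyclic successors of each other force length 2.\<close>
      then show False using assms(2) ij by (auto simp: mod_Suc split: if_splits)
    qed
  qed
  then show ?thesis by (simp add: cycle_edges_eq_image sum.reindex)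
qed

lemma sum_cyclic_shift:
  fixes f :: "nat \<Rightarrow> 'b :: comm_monoid_add"
  shows "(\<Sum>i<n. f (Suc i mod n)) = (\<Sum>i<n. f i)"
proof (cases n)
  case (Suc p)
  have "(\<Sum>i<p. f (Suc i mod Suc p)) = (\<Sum>i<p. f (Suc i))" by (intro sum.cong) auto
  then show ?thesis unfolding Suc sum.lessThan_Suc_shift[of f p] by (simp add: add.commute)
qed simp

text \<open>The colouring \<open>h\<close> changes exactly across the edges of \<open>L\<close>, and
  around the cycle each vertex value is counted twice, which vanishes in \<open>bit\<close>. The
  condition \<open>cut\<close> is local to the cycle because the set \<open>L\<close> used later is
  a coboundary only near the centre.\<close>

lemma cut_even_on_cycle:
  fixes h :: "'a \<Rightarrow> bit"
  assumes "distinct xs" "3 \<le> length xs"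
    and cut: "\<And>i. i < length xs \<Longrightarrow> (if {xs ! i, xs ! (Suc i mod length xs)} \<in> L then 1 else 0) =
      h (xs ! i) + h (xs ! (Suc i mod length xs))"
  shows "(\<Sum>e\<in>cycle_edges xs \<inter> L. 1::bit) = 0"
proof -
  let ?n = "length xs"
  have fin: "finite (cycle_edges xs)" unfolding cycle_edges_def by simp
  have "(\<Sum>e\<in>cycle_edges xs \<inter> L. 1::bit) = (\<Sum>e\<in>cycle_edges xs. if e \<in> L then 1 else 0)"
    by (rule sum.inter_restrict[OF fin])
  also have "\<dots> = (\<Sum>i<?n. h (xs ! i) + h (xs ! (Suc i mod ?n)))"
    unfolding sum_cycle_edges[OF assms(1,2)] by (intro sum.cong refl cut) simp
  also have "\<dots> = (\<Sum>i<?n. h (xs ! i)) + (\<Sum>i<?n. h (xs ! i))"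
    using sum_cyclic_shift[of "\<lambda>i. h (xs ! i)" ?n] by (simp only: sum.distrib)
  also have "b + b = 0" for b :: bit by simp
  finally show ?thesis .
qed

text \<open>Finite support is included because \<open>sum\<close> over an infinite set is 0 by
  default, which would break additivity.\<close>

lemma subspace_even_on:
  "edge_space.subspace {f :: 'a set \<Rightarrow> bit. finite {e. f e \<noteq> 0} \<and> (\<Sum>e | f e \<noteq> 0 \<and> e \<in> L. f e) = 0}"
  (is "edge_space.subspace {f. ?P f}")
proof (rule edge_space.subspaceI)
  fix f g :: "'a set \<Rightarrow> bit" assume "f \<in> {f. ?P f}" "g \<in> {f. ?P f}"
  then have fg: "?P f" "?P g" by auto
  let ?A = "{e. f e \<noteq> 0} \<union> {e. g e \<noteq> 0}"
  have fin: "finite ?A" using fg by simp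
  have sub: "{e. (f + g) e \<noteq> 0} \<subseteq> ?A" by auto
  have eq: "(\<Sum>e | u e \<noteq> 0 \<and> e \<in> L. u e) = (\<Sum>e\<in>?A \<inter> L. u e)"
    if "{e. u e \<noteq> 0} \<subseteq> ?A" for u :: "'a set \<Rightarrow> bit"
    using that fin by (intro sum.mono_neutral_left) auto
  have "(\<Sum>e | (f + g) e \<noteq> 0 \<and> e \<in> L. (f + g) e) = (\<Sum>e\<in>?A \<inter> L. f e) + (\<Sum>e\<in>?A \<inter> L. g e)"
    unfolding eq[OF sub] by (simp only: plus_fun_def sum.distrib)
  also have "\<dots> = 0" using eq[of f] eq[of g] fg by simp
  finally show "f + g \<in> {f. ?P f}" using finite_subset[OF sub fin] by blast
next
  fix c :: bit and f :: "'a set \<Rightarrow> bit" assume "f \<in> {f. ?P f}"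
  then show "(\<lambda>e. c * f e) \<in> {f. ?P f}" by (cases c) auto
qed auto

text \<open>Meeting \<open>L\<close> evenly is a linear condition, so it passes from the short
  cycles to their span, which contains every cycle.\<close>

lemma generated_cycles_even:
  assumes gen: "cycle_space_generated_upto k V E"
    and short: "\<And>C. graph_cycle V E C \<Longrightarrow> length C \<le> k \<Longrightarrow> (\<Sum>e\<in>cycle_edges C \<inter> L. 1::bit) = 0"
    and C: "graph_cycle V E C"
  shows "(\<Sum>e\<in>cycle_edges C \<inter> L. 1::bit) = 0"
proof -
  let ?P = "\<lambda>f :: 'a set \<Rightarrow> bit. finite {e. f e \<noteq> 0} \<and> (\<Sum>e | f e \<noteq> 0 \<and> e \<in> L. f e) = 0"
  have P_iff: "?P (indicator (cycle_edges C)) \<longleftrightarrow> (\<Sum>e\<in>cycle_edges C \<inter> L. 1::bit) = 0" for C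
  proof -
    have "{e. indicator (cycle_edges C) e \<noteq> (0::bit)} = cycle_edges C"
      by (auto simp: indicator_def)
    moreover have "{e. indicator (cycle_edges C) e \<noteq> (0::bit) \<and> e \<in> L} = cycle_edges C \<inter> L"
      by (auto simp: indicator_def)
    moreover have "finite (cycle_edges C)" unfolding cycle_edges_def by simp
    ultimately show ?thesis by simp
  qed
  have "edge_space.span {indicator (cycle_edges C) | C. graph_cycle V E C \<and> length C \<le> k} \<subseteq> {f. ?P f}"
    using short P_iff by (intro edge_space.span_minimal subspace_even_on) blast
  moreover have "indicator (cycle_edges C) \<in>
      edge_space.span {indicator (cycle_edges C) | C. graph_cycle V E C \<and> length C \<le> k}"
    using gen C unfolding cycle_space_generated_upto_def cycle_space_def
    by (metis (mono_tags, lifting) edge_space.span_base mem_Collect_eq)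
  ultimately show ?thesis using P_iff by blast
qed

lemma rtrancl_chain:
  assumes "\<And>l. i \<le> l \<Longrightarrow> l < j \<Longrightarrow> (g l, g (Suc l)) \<in> R" "i \<le> j"
  shows "(g i, g j) \<in> R\<^sup>*"
  using assms(2,1)
proof (induction j rule: dec_induct)
  case (step j)
  then have "(g i, g j) \<in> R\<^sup>*" "(g j, g (Suc j)) \<in> R" by simp_all
  then show ?case by (rule rtrancl_into_rtrancl)
qed simp

section \<open>Annuli around the midpoint of a geodesic\<close>

locale short_cycles_graph = conn_graph V E for V :: "'a set" and E +
  fixes k :: nat
  assumes generated: "cycle_space_generated_upto k V E"
begin

text \<open>With width \<open>k\<close>, a cycle of length at most \<open>k\<close> that has a
  vertex closer than \<open>s\<close> to \<open>m\<close> cannot get beyond the outer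
  radius.\<close>

definition annulus :: "'a \<Rightarrow> nat \<Rightarrow> 'a set" where
  "annulus m s = {v \<in> V. s \<le> d m v \<and> d m v \<le> s + k}"

lemma graph_cycle_adj:
  assumes "graph_cycle V E C" "i < length C"
  shows "(C ! i, C ! (Suc i mod length C)) \<in> adj E"
  using assms unfolding graph_cycle_def cycle_edges_def adj_def by auto

text \<open>Each edge changes the distance to \<open>m\<close> by at most 1, and the segment of the
  list between two entries has fewer than \<open>length C\<close> edges.\<close>

lemma cycle_dist_bound:
  assumes C: "graph_cycle V E C" and "m \<in> V" "v \<in> set C" "w \<in> set C"
  shows "d m w \<le> d m v + length C"
proof -
  have *: "d m (C ! j) \<le> d m (C ! i) + (j - i) \<and> d m (C ! i) \<le> d m (C ! j) + (j - i)"
    if "i \<le> j" "j < length C" for i j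
    using that
  proof (induction j rule: dec_induct)
    case (step j)
    then have "(C ! j, C ! Suc j) \<in> adj E" using graph_cycle_adj[OF C, of j] by simp
    then show ?case using step d_step[OF \<open>m \<in> V\<close>, of "C ! j" "C ! Suc j"] by fastforce
  qed simp
  obtain i j where ij: "v = C ! i" "w = C ! j" "i < length C" "j < length C"
    using assms by (metis in_set_conv_nth)
  show ?thesis
  proof (cases "i \<le> j")
    case True then show ?thesis using *[OF True ij(4)] ij by auto
  next
    case False then have "j \<le> i" by simp then show ?thesis using *[OF _ ij(3), of j] ij by auto
  qed
qed

text \<open>Otherwise the geodesic enters the inner ball through an edge of \<open>L\<close> at
  \<open>a\<close> and leaves it at a point outside \<open>K\<close>, while \<open>avoid\<close>
  leads back outside the ball. This yields a cycle with exactly one edge in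
  \<open>L\<close>.\<close>

lemma annulus_connects:
  assumes step: "\<And>i. i < N \<Longrightarrow> (g i, g (Suc i)) \<in> adj E"
    and V: "\<And>i. i \<le> N \<Longrightarrow> g i \<in> V"
    and geo: "\<And>i j. i \<le> j \<Longrightarrow> j \<le> N \<Longrightarrow> d (g i) (g j) = j - i"
    and s: "0 < s" "s \<le> t" "t + s \<le> N"
    and avoid: "(g N, g 0) \<in> (Restr (adj E) {v. s \<le> d (g t) v})\<^sup>*"
  shows "(g (t - s), g (t + s)) \<in> (Restr (adj E) (annulus (g t) s))\<^sup>*"
proof (rule ccontr)
  define m a a' where "m = g t" and "a = g (t - s)" and "a' = g (Suc (t - s))"
  let ?A = "annulus m s"
  define K where "K = {v. (a, v) \<in> (Restr (adj E) ?A)\<^sup>*}"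
  \<comment> \<open>Edges leaving \<open>K\<close> beyond the outer radius are left out, so
    \<open>L\<close> is the coboundary of \<open>K\<close> only within distance \<open>s + k\<close>
    of \<open>m\<close>.\<close>
  define L where "L = {{u, v} | u v. (u, v) \<in> adj E \<and> u \<in> K \<and> d m v < s}"
  assume "\<not> ?thesis"
  then have b: "g (t + s) \<notin> K" by (simp add: K_def a_def m_def)
  have mV: "m \<in> V" using V s by (simp add: m_def)
  have dm: "d m (g i) = (if i \<le> t then t - i else i - t)" if "i \<le> N" for i
    using that geo[of i t] geo[of t i] d_commute[of "g i" "g t"] V[of i] V[of t] s
    by (auto simp: m_def)
  have aA: "a \<in> ?A" using dm[of "t - s"] V[of "t - s"] s by (auto simp: annulus_def a_def)
  have KA: "K \<subseteq> ?A"
  proof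
    fix v assume "v \<in> K"
    then have "(a, v) \<in> (Restr (adj E) ?A)\<^sup>*" by (simp add: K_def)
    then show "v \<in> ?A" by cases (use aA in auto)
  qed
  have K_ge: "v \<in> K \<Longrightarrow> s \<le> d m v" for v using KA by (auto simp: annulus_def)
  have L_iff: "{u, v} \<in> L \<longleftrightarrow> (u \<in> K \<and> d m v < s) \<or> (v \<in> K \<and> d m u < s)"
    if "(u, v) \<in> adj E" for u v
    unfolding L_def using that adj_sym[OF that] by (auto simp: doubleton_eq_iff)
  have short: "(\<Sum>e\<in>cycle_edges C \<inter> L. 1::bit) = 0"
    if C: "graph_cycle V E C" and len: "length C \<le> k" for C
  proof (cases "cycle_edges C \<inter> L = {}")
    case False
    then obtain e where e: "e \<in> cycle_edges C" "e \<in> L" by blast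
    \<comment> \<open>Every edge of \<open>L\<close> has an end in the inner ball, so a short cycle
      through it stays within distance \<open>s + k\<close>.\<close>
    then obtain v where v: "v \<in> e" "d m v < s" by (auto simp: L_def)
    have "l mod length C < length C" for l
      using C by (intro mod_less_divisor) (auto simp: graph_cycle_def)
    then have "v \<in> set C" using e(1) v(1) by (auto simp: cycle_edges_def)
    then have near: "d m w \<le> s + k" if "w \<in> set C" for w
      using cycle_dist_bound[OF C mV _ that, of v] v(2) len by simp
    let ?h = "\<lambda>v. if v \<in> K then 1 else (0::bit)"
    show ?thesis
    proof (rule cut_even_on_cycle[where h = ?h])
      show "distinct C" "3 \<le> length C" using C by (auto simp: graph_cycle_def)
      fix i assume i: "i < length C"
      define u v where "u = C ! i" and "v = C ! (Suc i mod length C)"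
      have uv: "(u, v) \<in> adj E" using graph_cycle_adj[OF C i] by (simp add: u_def v_def)
      have "Suc i mod length C < length C" using i by (intro mod_less_divisor) linarith
      then have le: "d m u \<le> s + k" "d m v \<le> s + k"
        using near i by (auto simp: u_def v_def)
      \<comment> \<open>An edge from \<open>K\<close> to a vertex of the annulus stays in
        \<open>K\<close>. Within distance \<open>s + k\<close>, \<open>K\<close> can thus be left
        only towards the centre.\<close>
      have close: "v \<in> K" if "(u, v) \<in> adj E" "u \<in> K" "s \<le> d m v" "d m v \<le> s + k" for u v
      proof -
        have "(u, v) \<in> Restr (adj E) ?A" using that KA adjD[OF that(1)] by (auto simp: annulus_def)
        with that(2) show ?thesis by (auto simp: K_def intro: rtrancl_into_rtrancl)
      qed
      have "{u, v} \<in> L \<longleftrightarrow> (u \<in> K) \<noteq> (v \<in> K)"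
        unfolding L_iff[OF uv]
        using close[OF uv] close[OF adj_sym[OF uv]] le K_ge[of u] K_ge[of v] by force
      then show "(if {C ! i, C ! (Suc i mod length C)} \<in> L then 1 else 0) =
          ?h (C ! i) + ?h (C ! (Suc i mod length C))"
        unfolding u_def v_def by auto
    qed
  qed simp
  \<comment> \<open>The geodesic passes between the distances \<open>s\<close> and
    \<open>s - 1\<close> only at the indices \<open>t - s\<close> and \<open>t + s - 1\<close>; the
    second edge ends in \<open>g (t + s)\<close>, which is not in \<open>K\<close>.\<close>
  have RL: "(g i, g (Suc i)) \<in> adj (E - L)" if i: "i < N" "i \<noteq> t - s" for i
  proof -
    have "{g i, g (Suc i)} \<notin> L"
    proof
      assume "{g i, g (Suc i)} \<in> L"
      then consider "g i \<in> K" "d m (g (Suc i)) < s" | "g (Suc i) \<in> K" "d m (g i) < s"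
        using L_iff[OF step[OF i(1)]] by blast
      then show False
      proof cases
        case 1
        then show False using K_ge[OF 1(1)] dm[of i] dm[of "Suc i"] i s by (auto split: if_splits)
      next
        case 2
        then have "Suc i = t + s"
          using K_ge[OF 2(1)] dm[of i] dm[of "Suc i"] i s by (auto split: if_splits)
        with 2 b show False by simp
      qed
    qed
    with step[OF i(1)] show ?thesis by (simp add: adj_def)
  qed
  have "Restr (adj E) {v. s \<le> d m v} \<subseteq> adj (E - L)"
    using L_iff by (fastforce simp: adj_def)
  then have "(g N, g 0) \<in> (adj (E - L))\<^sup>*" using avoid rtrancl_mono unfolding m_def by blast
  moreover have "(a', g N) \<in> (adj (E - L))\<^sup>*" "(g 0, a) \<in> (adj (E - L))\<^sup>*"
    unfolding a_def a'_def using s by (auto intro!: rtrancl_chain RL)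
  \<comment> \<open>From \<open>a'\<close> forward to \<open>g N\<close>, along \<open>avoid\<close>
    to \<open>g 0\<close>, and forward again to \<open>a\<close>, all without edges of
    \<open>L\<close>.\<close>
  ultimately have "(a', a) \<in> (adj (E - L))\<^sup>*" by (meson rtrancl_trans)
  then obtain n where n: "(a', a) \<in> adj (E - L) ^^ n" by (auto simp: rtrancl_power)
  have sim: "simple_graph V (E - L)" using simple by (auto simp: simple_graph_def)
  have edge: "(a, a') \<in> adj E" unfolding a_def a'_def using s by (intro step) linarith
  have "a \<in> K" by (simp add: K_def)
  moreover have "d m a' < s" unfolding a'_def using dm[of "Suc (t - s)"] s by auto
  ultimately have eL: "{a, a'} \<in> L" using L_iff[OF edge] by blast
  obtain xs where xs: "graph_path V (E - L) a' xs a"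
    using relpow_imp_graph_path[OF sim _ n] adjD[OF edge] by blast
  let ?n = "length xs"
  have ends: "xs \<noteq> []" "xs ! 0 = a'" "xs ! (?n - 1) = a" "distinct xs" "set xs \<subseteq> V"
    using xs by (auto simp: graph_path_def hd_conv_nth last_conv_nth)
  have mid: "{xs ! i, xs ! Suc i} \<in> E - L" if "Suc i < ?n" for i
    using xs that by (auto simp: graph_path_def successively_conv_nth)
  \<comment> \<open>One vertex would give \<open>a = a'\<close>, and two would make the path use the
    edge from \<open>a'\<close> to \<open>a\<close>, which lies in \<open>L\<close>. So the
    closed-up path is a genuine cycle.\<close>
  have "?n \<noteq> 1" using ends adjD[OF edge] by auto
  moreover have "?n \<noteq> 2" using mid[of 0] ends eL by (auto simp: insert_commute)
  moreover have "?n \<noteq> 0" using ends(1) by simp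
  ultimately have n3: "3 \<le> ?n" by linarith
  have ce: "{xs ! i, xs ! (Suc i mod ?n)} = (if i = ?n - 1 then {a, a'} else {xs ! i, xs ! Suc i})"
    if "i < ?n" for i
    using that ends by auto
  have "cycle_edges xs \<subseteq> E"
    using mid edge by (auto simp: cycle_edges_def ce adj_iff)
  then have cyc: "graph_cycle V E xs" using ends n3 by (simp add: graph_cycle_def)
  have "?n - 1 < ?n" using n3 by linarith
  then have "{a, a'} \<in> cycle_edges xs"
    unfolding cycle_edges_def using ce[of "?n - 1"] by fastforce
  moreover have "e = {a, a'}" if "e \<in> cycle_edges xs" "e \<in> L" for e
  proof -
    from that(1) obtain i where i: "i < ?n" "e = {xs ! i, xs ! (Suc i mod ?n)}"
      by (auto simp: cycle_edges_def)
    then show ?thesis using ce[OF i(1)] mid[of i] that(2) by (cases "i = ?n - 1") auto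
  qed
  ultimately have "cycle_edges xs \<inter> L = {{a, a'}}" using eL by blast
  then show False using generated_cycles_even[OF generated short cyc] by simp
qed

text \<open>A discrete intermediate value argument: each edge raises the distance from
  \<open>a\<close> by at most 1, so no value is skipped.\<close>

lemma Restr_walk_dist_surj:
  assumes "(a, b) \<in> (Restr (adj E) A)\<^sup>*" "a \<in> A" "a \<in> V"
  shows "{..d a b} \<subseteq> d a ` A"
  using assms(1)
proof induction
  case base
  then show ?case using assms by (auto intro!: image_eqI[of _ _ a])
next
  case (step y z)
  then have "d a z \<le> Suc (d a y)" using d_step(1)[OF assms(3)] by auto
  then have "{..d a z} \<subseteq> insert (d a z) {..d a y}" by auto
  with step show ?case by auto
qed

text \<open>The walk given by \<open>annulus_connects\<close> joins two points at distance
  \<open>2 * s\<close>, so it meets all \<open>2 * s + 1\<close> distances from the first one. For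
  radius 0, where there is no inner ball, the centre suffices.\<close>

lemma card_annulus_ge:
  assumes step: "\<And>i. i < N \<Longrightarrow> (g i, g (Suc i)) \<in> adj E"
    and V: "\<And>i. i \<le> N \<Longrightarrow> g i \<in> V"
    and geo: "\<And>i j. i \<le> j \<Longrightarrow> j \<le> N \<Longrightarrow> d (g i) (g j) = j - i"
    and s: "s \<le> t" "t + s \<le> N"
    and avoid: "(g N, g 0) \<in> (Restr (adj E) {v. s \<le> d (g t) v})\<^sup>*"
    and fin: "finite (annulus (g t) s)"
  shows "2 * s + 1 \<le> card (annulus (g t) s)"
proof (cases "s = 0")
  case True
  then have "g t \<in> annulus (g t) s" using V s by (simp add: annulus_def)
  then show ?thesis using True fin by (metis One_nat_def Suc_leI add_0 card_gt_0_iff empty_iff mult_0_right)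
next
  case False
  let ?A = "annulus (g t) s"
  have inA: "g (t - s) \<in> ?A"
    using geo[of "t - s" t] d_commute[of "g (t - s)" "g t"] V s by (simp add: annulus_def)
  have "{..d (g (t - s)) (g (t + s))} \<subseteq> d (g (t - s)) ` ?A"
    using annulus_connects[OF step V geo _ s avoid] False inA V s by (intro Restr_walk_dist_surj) auto
  moreover have "d (g (t - s)) (g (t + s)) = 2 * s" using geo[of "t - s" "t + s"] s by simp
  ultimately have "card {..2 * s} \<le> card ?A" using surj_card_le[OF fin] by metis
  then show ?thesis by simp
qed

text \<open>Disjoint annuli whose inner radii are multiples of \<open>k + 1\<close> are packed into
  the ball; lower bounds by consecutive odd numbers sum to a square.\<close>

lemma card_ball_ge:
  assumes step: "\<And>i. i < N \<Longrightarrow> (g i, g (Suc i)) \<in> adj E"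
    and V: "\<And>i. i \<le> N \<Longrightarrow> g i \<in> V"
    and geo: "\<And>i j. i \<le> j \<Longrightarrow> j \<le> N \<Longrightarrow> d (g i) (g j) = j - i"
    and r: "r \<le> t" "t + r \<le> N"
    and avoid: "(g N, g 0) \<in> (Restr (adj E) {v. r \<le> d (g t) v})\<^sup>*"
    and fin: "finite (graph_ball V E (g t) r)"
  shows "(real r)\<^sup>2 / (4 * (real k + 1)\<^sup>2) \<le> real (card (graph_ball V E (g t) r))"
proof -
  let ?B = "graph_ball V E (g t) r"
  \<comment> \<open>The outermost of \<open>J\<close> annuli has outer radius
    \<open>J * (k + 1) - 1\<close>; this is the largest \<open>J\<close> that keeps it at most
    \<open>r\<close>.\<close>
  define J where "J = (r + 1) div (k + 1)"
  let ?A = "\<lambda>j. annulus (g t) (j * (k + 1))"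
  have le: "j * (k + 1) + k \<le> r" if "j < J" for j
  proof -
    have "Suc j * (k + 1) \<le> J * (k + 1)" using that by (intro mult_right_mono) auto
    also have "\<dots> \<le> r + 1" unfolding J_def by (rule div_times_less_eq_dividend)
    finally show ?thesis by simp
  qed
  have sub: "?A j \<subseteq> ?B" if "j < J" for j
    using le[OF that] by (auto simp: annulus_def graph_ball_def)
  have card: "2 * j + 1 \<le> card (?A j)" if "j < J" for j
  proof -
    have jr: "j * (k + 1) \<le> r" using le[OF that] by linarith
    have "Restr (adj E) {v. r \<le> d (g t) v} \<subseteq> Restr (adj E) {v. j * (k + 1) \<le> d (g t) v}"
      using jr by auto
    then have "(g N, g 0) \<in> (Restr (adj E) {v. j * (k + 1) \<le> d (g t) v})\<^sup>*"
      using avoid rtrancl_mono by blast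
    then have "2 * (j * (k + 1)) + 1 \<le> card (?A j)"
      using r jr finite_subset[OF sub[OF that] fin]
      by (intro card_annulus_ge[of N g, OF step V geo]) auto
    \<comment> \<open>The factor \<open>k + 1\<close> is dropped to get the consecutive odd
      numbers.\<close>
    then show ?thesis by simp
  qed
  have disj: "?A i \<inter> ?A j = {}" if "i < j" for i j
  proof -
    have "Suc i * (k + 1) \<le> j * (k + 1)" using that by (intro mult_right_mono) auto
    then show ?thesis by (auto simp: annulus_def)
  qed
  have "J\<^sup>2 = (\<Sum>j<J. 2 * j + 1)"
    by (induction J) (auto simp: power2_eq_square)
  also have "\<dots> \<le> (\<Sum>j<J. card (?A j))" using card by (intro sum_mono) auto
  also have "\<dots> = card (\<Union>j<J. ?A j)"
    using sub fin disj
    by (intro card_UN_disjoint[symmetric]) (auto intro: finite_subset, (metis IntI disj empty_iff nat_neq_iff)+)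
  also have "\<dots> \<le> card ?B" using sub fin by (intro card_mono) auto
  finally have J: "J\<^sup>2 \<le> card ?B" .
  have "g t \<in> ?B" using V r by (simp add: graph_ball_def)
  then have one: "1 \<le> card ?B" using fin by (metis One_nat_def Suc_leI card_gt_0_iff empty_iff)
  have "r + 1 < (J + 1) * (k + 1)"
    unfolding J_def using dividend_less_div_times[of "k + 1" "r + 1"] by simp
  then have r_less: "r < (J + 1) * (k + 1)" by simp
  \<comment> \<open>For \<open>r < k\<close> no annulus fits and the centre alone supplies the
    bound, so 1 takes the place of \<open>J\<close>.\<close>
  define M where "M = (if J = 0 then 1 else J)"
  have "r \<le> 2 * (M * (k + 1))"
  proof (cases "J = 0")
    case False
    then have "(J + 1) * (k + 1) \<le> (2 * J) * (k + 1)" by (intro mult_right_mono) auto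
    with r_less False show ?thesis by (simp add: M_def)
  qed (use r_less in \<open>simp add: M_def\<close>)
  then have "r\<^sup>2 \<le> (2 * (M * (k + 1)))\<^sup>2" by (rule power_mono) simp
  also have "\<dots> = M\<^sup>2 * (4 * (k + 1)\<^sup>2)" by (simp add: power2_eq_square algebra_simps)
  also have "\<dots> \<le> card ?B * (4 * (k + 1)\<^sup>2)"
    using J one by (intro mult_right_mono) (auto simp: M_def)
  finally have "real (r\<^sup>2) \<le> real (card ?B * (4 * (k + 1)\<^sup>2))" by linarith
  also have "real (card ?B * (4 * (k + 1)\<^sup>2)) = real (card ?B) * (4 * (real k + 1)\<^sup>2)"
    by (simp add: add.commute)
  finally show ?thesis by (subst pos_divide_le_eq) simp_all
qed

end

section \<open>The tree of clusters\<close>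

locale rooted_graph = conn_graph V E for V :: "'a set" and E +
  fixes root
  assumes root: "root \<in> V"
begin

abbreviation lev where "lev \<equiv> d root"

definition same_cluster :: "'a \<Rightarrow> 'a \<Rightarrow> bool" where
  "same_cluster x y \<longleftrightarrow> x \<in> V \<and> y \<in> V \<and> lev x = lev y \<and>
     (x, y) \<in> (Restr (adj E) {v. lev x \<le> lev v})\<^sup>*"

text \<open>A cluster is represented by one of its vertices, which keeps the tree on the vertex type
  of the graph, as \<open>quasi_isometric_to_tree\<close> asks.\<close>

definition rep :: "'a \<Rightarrow> 'a" where
  "rep x = (SOME y. same_cluster x y)"

definition cluster_edges :: "'a set set" where
  "cluster_edges = {{rep u, rep v} | u v. (u, v) \<in> adj E \<and> rep u \<noteq> rep v}"

lemma rtrancl_Restr_sym: "(x, y) \<in> (Restr (adj E) A)\<^sup>* \<Longrightarrow> (y, x) \<in> (Restr (adj E) A)\<^sup>*"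
  by (rule symD[OF sym_rtrancl]) (auto intro!: symI adj_sym)

lemma same_cluster_refl: "x \<in> V \<Longrightarrow> same_cluster x x"
  by (simp add: same_cluster_def)

lemma same_cluster_sym: "same_cluster x y \<Longrightarrow> same_cluster y x"
  by (auto simp: same_cluster_def intro: rtrancl_Restr_sym)

lemma same_cluster_trans: "same_cluster x y \<Longrightarrow> same_cluster y z \<Longrightarrow> same_cluster x z"
  unfolding same_cluster_def by (auto intro: rtrancl_trans)

lemma same_cluster_rep: "x \<in> V \<Longrightarrow> same_cluster x (rep x)"
  unfolding rep_def by (rule someI[of "same_cluster x" x]) (rule same_cluster_refl)

lemma rep_eq_iff: "x \<in> V \<Longrightarrow> y \<in> V \<Longrightarrow> rep x = rep y \<longleftrightarrow> same_cluster x y"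
proof
  assume "same_cluster x y"
  then have "same_cluster x = same_cluster y"
    using same_cluster_sym same_cluster_trans by blast
  then show "rep x = rep y" by (simp add: rep_def)
qed (metis same_cluster_rep same_cluster_sym same_cluster_trans)

lemma rep_in: "x \<in> V \<Longrightarrow> rep x \<in> V"
  using same_cluster_rep by (auto simp: same_cluster_def)

lemma lev_rep: "x \<in> V \<Longrightarrow> lev (rep x) = lev x"
  using same_cluster_rep by (auto simp: same_cluster_def)

lemma same_cluster_adj:
  assumes "(u, v) \<in> adj E" "lev u = lev v"
  shows "same_cluster u v"
  using assms adjD[OF assms(1)] by (auto simp: same_cluster_def)

text \<open>The walk joining \<open>u\<close> and \<open>u'\<close> stays above the level of
  \<open>v\<close>, so the two downward edges extend it to a walk from \<open>v\<close> to
  \<open>v'\<close>. This is why a cluster has only one parent.\<close>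

lemma same_cluster_parents:
  assumes "same_cluster u u'" "(u, v) \<in> adj E" "(u', v') \<in> adj E"
    and "lev u = Suc (lev v)" "lev u' = Suc (lev v')"
  shows "same_cluster v v'"
proof -
  let ?R = "Restr (adj E) {w. lev v \<le> lev w}"
  have "Restr (adj E) {w. lev u \<le> lev w} \<subseteq> ?R" using assms(4) by auto
  then have "(u, u') \<in> ?R\<^sup>*" using assms(1) rtrancl_mono unfolding same_cluster_def by blast
  moreover have "lev u = lev u'" using assms(1) by (simp add: same_cluster_def)
  then have "(v, u) \<in> ?R" "(u', v') \<in> ?R" using assms adj_sym by auto
  ultimately have "(v, v') \<in> ?R\<^sup>*" by (meson converse_rtrancl_into_rtrancl rtrancl_into_rtrancl)
  then show ?thesis
    using adjD[OF assms(2)] adjD[OF assms(3)] assms(4,5) \<open>lev u = lev u'\<close>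
    by (simp add: same_cluster_def)
qed

lemma cluster_adjE:
  assumes "(p, q) \<in> adj cluster_edges"
  obtains u v where "(u, v) \<in> adj E" "p = rep u" "q = rep v" "p \<noteq> q"
proof -
  from assms obtain u v where "(u, v) \<in> adj E" "{p, q} = {rep u, rep v}" "rep u \<noteq> rep v"
    by (auto simp: adj_iff cluster_edges_def)
  then show ?thesis using that[of u v] that[of v u] adj_sym[of u v] by (auto simp: doubleton_eq_iff)
qed

text \<open>Levels of adjacent vertices differ by at most 1, and adjacent vertices of equal level
  share a cluster.\<close>

lemma cluster_adj_lev:
  assumes "(u, v) \<in> adj E" "rep u \<noteq> rep v"
  shows "lev u = Suc (lev v) \<or> lev v = Suc (lev u)"
  using d_step[OF root assms(1)] same_cluster_adj[OF assms(1)] rep_eq_iff adjD[OF assms(1)] assms(2)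
  by force

text \<open>A neighbouring cluster of no higher level lies exactly one level below, so
  \<open>same_cluster_parents\<close> applies to the graph edges that induce the two cluster
  edges.\<close>

lemma cluster_parent_unique:
  assumes "(c, p) \<in> adj cluster_edges" "(c, q) \<in> adj cluster_edges" "lev p \<le> lev c" "lev q \<le> lev c"
  shows "p = q"
proof -
  from assms(1) obtain u v where 1: "(u, v) \<in> adj E" "c = rep u" "p = rep v" "c \<noteq> p"
    by (rule cluster_adjE)
  from assms(2) obtain u' v' where 2: "(u', v') \<in> adj E" "c = rep u'" "q = rep v'" "c \<noteq> q"
    by (rule cluster_adjE)
  note V = adjD[OF 1(1)] adjD[OF 2(1)]
  have "rep u = rep u'" using 1(2) 2(2) by simp
  then have "same_cluster u u'" using rep_eq_iff V by blast
  moreover have "lev c = lev u" "lev p = lev v" "lev c = lev u'" "lev q = lev v'"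
    using 1(2,3) 2(2,3) V lev_rep by metis+
  then have "lev u = Suc (lev v)" "lev u' = Suc (lev v')"
    using cluster_adj_lev[OF 1(1)] cluster_adj_lev[OF 2(1)] 1(2-4) 2(2-4) assms(3,4) by force+
  ultimately have "same_cluster v v'" using same_cluster_parents 1(1) 2(1) by blast
  then show ?thesis using 1 2 V rep_eq_iff by auto
qed

lemma simple_cluster_graph: "simple_graph (rep ` V) cluster_edges"
  unfolding simple_graph_def
proof
  fix e assume "e \<in> cluster_edges"
  then obtain u v where "(u, v) \<in> adj E" "e = {rep u, rep v}" "rep u \<noteq> rep v"
    by (auto simp: cluster_edges_def)
  then show "\<exists>x\<in>rep ` V. \<exists>y\<in>rep ` V. x \<noteq> y \<and> e = {x, y}"
    using adjD[of u v] by (intro bexI[of _ "rep u"] bexI[of _ "rep v"] conjI imageI) simp_all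
qed

text \<open>Steps inside a cluster collapse. This serves both connectedness and the upper distance
  bound.\<close>

lemma cluster_walk:
  assumes "(x, y) \<in> adj E ^^ n"
  shows "\<exists>m\<le>n. (rep x, rep y) \<in> adj cluster_edges ^^ m"
  using assms
proof (induction n arbitrary: y)
  case (Suc n)
  then obtain w where w: "(x, w) \<in> adj E ^^ n" "(w, y) \<in> adj E" by auto
  from Suc.IH[OF w(1)] obtain m where m: "m \<le> n" "(rep x, rep w) \<in> adj cluster_edges ^^ m" by blast
  show ?case
  proof (cases "rep w = rep y")
    case True
    then show ?thesis using m by (metis le_SucI)
  next
    case False
    then have "(rep w, rep y) \<in> adj cluster_edges" using w(2) by (auto simp: adj_iff cluster_edges_def)
    then have "(rep x, rep y) \<in> adj cluster_edges ^^ Suc m" using m by auto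
    with m show ?thesis by (metis Suc_le_mono)
  qed
qed auto

lemma connected_cluster_graph: "connected_graph (rep ` V) cluster_edges"
proof (rule connected_graphI[OF simple_cluster_graph])
  show "rep ` V \<noteq> {}" using root by blast
next
  fix p q assume "p \<in> rep ` V" "q \<in> rep ` V"
  then obtain x y where "x \<in> V" "y \<in> V" "p = rep x" "q = rep y" by blast
  then obtain m where "(p, q) \<in> adj cluster_edges ^^ m"
    using cluster_walk[OF relpow_d[of x y]] by blast
  then show "(p, q) \<in> (adj cluster_edges)\<^sup>*" by (rule relpow_imp_rtrancl)
qed

text \<open>On a cycle of clusters, both neighbours of a cluster of maximal level would be its parent.\<close>

lemma is_tree_cluster_graph: "is_tree (rep ` V) cluster_edges"
  unfolding is_tree_def
proof (intro conjI connected_cluster_graph notI)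
  assume "\<exists>xs. graph_cycle (rep ` V) cluster_edges xs"
  then obtain xs where xs: "3 \<le> length xs" "distinct xs" "cycle_edges xs \<subseteq> cluster_edges"
    by (auto simp: graph_cycle_def)
  let ?n = "length xs"
  have adj: "(xs ! i, xs ! (Suc i mod ?n)) \<in> adj cluster_edges" if "i < ?n" for i
    using xs(3) that by (auto simp: adj_iff cycle_edges_def)
  define M where "M = Max (lev ` set xs)"
  have "M \<in> lev ` set xs" unfolding M_def using xs(1) by (intro Max_in) auto
  then obtain i where i: "i < ?n" "M = lev (xs ! i)" by (metis imageE in_set_conv_nth)
  have le: "lev (xs ! j) \<le> lev (xs ! i)" if "j < ?n" for j
    unfolding i(2)[symmetric] M_def using that by (intro Max_ge) auto
  define j where "j = (if i = 0 then ?n - 1 else i - 1)"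
  have j: "j < ?n" "Suc j mod ?n = i" using i(1) by (auto simp: j_def)
  have lt: "Suc i mod ?n < ?n" using i(1) by (intro mod_less_divisor) linarith
  have "(xs ! i, xs ! j) \<in> adj cluster_edges" using adj[OF j(1)] j(2) adj_sym by metis
  then have "xs ! j = xs ! (Suc i mod ?n)"
    using adj[OF i(1)] le j(1) lt by (blast intro: cluster_parent_unique)
  \<comment> \<open>Cyclic predecessor and successor of \<open>i\<close> coincide, which is
    impossible for length at least 3.\<close>
  then have "j = Suc i mod ?n" using xs(2) j(1) lt by (simp add: nth_eq_iff_index_eq)
  then show False using xs(1) i(1) by (auto simp: j_def mod_Suc split: if_splits)
qed

text \<open>Projection does not increase distances. Conversely, representatives of adjacent clusters
  are at distance at most \<open>2 * D + 1\<close>: at most \<open>D\<close> within each cluster and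
  one edge across.\<close>

lemma quasi_isometry_rep:
  assumes D: "\<And>x y. same_cluster x y \<Longrightarrow> d x y \<le> D"
  shows "quasi_isometry V E (rep ` V) cluster_edges rep"
proof -
  let ?T = "rep ` V" and ?F = cluster_edges
  interpret T: conn_graph ?T ?F by unfold_locales (rule connected_cluster_graph)
  have upper: "graph_dist ?T ?F (rep x) (rep y) \<le> d x y" if "x \<in> V" "y \<in> V" for x y
    using cluster_walk[OF relpow_d[OF that]] T.d_le_relpow[of "rep x" "rep y"] that
    by (meson imageI order_trans)
  have rep_D: "d x (rep x) \<le> D" "d (rep x) x \<le> D" if "x \<in> V" for x
    using D[OF same_cluster_rep[OF that]] D[OF same_cluster_sym[OF same_cluster_rep[OF that]]] by auto
  have edge: "d p q \<le> 2 * D + 1" if pq: "(p, q) \<in> adj ?F" for p q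
  proof -
    from pq obtain u v where uv: "(u, v) \<in> adj E" "p = rep u" "q = rep v" by (rule cluster_adjE)
    note V = adjD[OF uv(1)]
    have "d p q \<le> d p u + (d u v + d v q)"
      using d_triangle[of p u q] d_triangle[of u v q] V uv rep_in by fastforce
    then show ?thesis using rep_D(2)[OF V(1)] rep_D(1)[OF V(2)] d_adj[OF uv(1)] unfolding uv(2,3) by linarith
  qed
  have walk: "q \<in> V \<and> d p q \<le> (2 * D + 1) * n" if "(p, q) \<in> adj ?F ^^ n" "p \<in> V" for p q n
    using that
  proof (induction n arbitrary: q)
    case (Suc n)
    then obtain w where w: "(p, w) \<in> adj ?F ^^ n" "(w, q) \<in> adj ?F" by auto
    have "q \<in> V" using T.adjD[OF w(2)] rep_in by auto
    moreover have "d p q \<le> d p w + d w q"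
      using Suc.IH[OF w(1)] Suc.prems \<open>q \<in> V\<close> by (intro d_triangle) auto
    ultimately show ?case using Suc.IH[OF w(1)] Suc.prems edge[OF w(2)] by auto
  qed auto
  have lower: "d x y \<le> 2 * D + (2 * D + 1) * graph_dist ?T ?F (rep x) (rep y)"
    if "x \<in> V" "y \<in> V" for x y
  proof -
    have "d x y \<le> d x (rep x) + (d (rep x) (rep y) + d (rep y) y)"
      using d_triangle[of x "rep x" y] d_triangle[of "rep x" "rep y" y] that rep_in by fastforce
    moreover have "d (rep x) (rep y) \<le> (2 * D + 1) * graph_dist ?T ?F (rep x) (rep y)"
      using walk[OF T.relpow_d[of "rep x" "rep y"]] that rep_in by auto
    ultimately show ?thesis using rep_D[OF that(1)] rep_D[OF that(2)] by linarith
  qed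
  show ?thesis
    unfolding quasi_isometry_def
  \<comment> \<open>The same number serves as multiplicative and as additive constant.\<close>
  proof (intro conjI exI[of _ "real (2 * D + 1)"] ballI)
    fix x y assume xy: "x \<in> V" "y \<in> V"
    let ?t = "graph_dist ?T ?F (rep x) (rep y)"
    show "real ?t \<le> real (2 * D + 1) * real (d x y) + real (2 * D + 1)"
    proof -
      have "?t \<le> (2 * D + 1) * d x y + (2 * D + 1)" using upper[OF xy] by (simp add: trans_le_add1)
      then show ?thesis by (metis of_nat_add of_nat_le_iff of_nat_mult)
    qed
    have "d x y \<le> (2 * D + 1) * (?t + (2 * D + 1))" using lower[OF xy] by (simp add: algebra_simps)
    then have "real (d x y) \<le> real (2 * D + 1) * (real ?t + real (2 * D + 1))"
      by (metis of_nat_add of_nat_le_iff of_nat_mult)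
    then have "real (d x y) / real (2 * D + 1) \<le> real ?t + real (2 * D + 1)"
      by (subst pos_divide_le_eq) (simp_all add: mult.commute)
    then show "inverse (real (2 * D + 1)) * real (d x y) - real (2 * D + 1) \<le> real ?t"
      by (simp add: divide_inverse mult.commute)
  next
    fix z assume "z \<in> ?T"
    then obtain x where x: "x \<in> V" "z = rep x" by blast
    then have "graph_dist ?T ?F z (rep x) = 0" by simp
    with x show "\<exists>x\<in>V. real (graph_dist ?T ?F z (rep x)) \<le> real (2 * D + 1)"
      by (intro bexI[of _ x]) simp_all
  qed auto
qed

text \<open>A point of the geodesic closer than \<open>r\<close> to \<open>m\<close> has level above
  \<open>lev m - r\<close>, hence is less than \<open>2 * r\<close> away from \<open>z\<close>, and
  \<open>z\<close> would be within \<open>3 * r\<close> of \<open>m\<close>.\<close>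

lemma geodesic_to_root_avoids:
  assumes "m \<in> V" "z \<in> V" "lev z \<le> lev m + r" "3 * r < d m z"
  shows "(root, z) \<in> (Restr (adj E) {v. r \<le> d m v})\<^sup>*"
proof -
  obtain h where h: "h 0 = root" "h (lev z) = z" "\<And>i. i < lev z \<Longrightarrow> (h i, h (Suc i)) \<in> adj E"
    "\<And>i. i \<le> lev z \<Longrightarrow> h i \<in> V" "\<And>i j. i \<le> j \<Longrightarrow> j \<le> lev z \<Longrightarrow> d (h i) (h j) = j - i"
    using obtain_geodesic[OF root assms(2)] by blast
  have far: "r \<le> d m (h i)" if "i \<le> lev z" for i
  proof (rule ccontr)
    assume near: "\<not> ?thesis"
    have "lev (h i) = i" using h(5)[of 0 i] h(1) that by simp
    moreover have "d (h i) z = lev z - i" using h(5)[of i "lev z"] h(2) that by simp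
    moreover have "lev m \<le> lev (h i) + d (h i) m" "d m z \<le> d m (h i) + d (h i) z"
      "d (h i) m = d m (h i)"
      using h(4)[OF that] assms root by (auto intro: d_triangle d_commute)
    ultimately show False using near assms(3,4) that by linarith
  qed
  have "(h 0, h (lev z)) \<in> (Restr (adj E) {v. r \<le> d m v})\<^sup>*"
    by (rule rtrancl_chain) (auto intro: far h(3))
  then show ?thesis using h by simp
qed

end

section \<open>The dichotomy for a single graph\<close>

lemma (in short_cycles_graph) quasi_isometric_to_tree_or_quadratic_balls:
  "quasi_isometric_to_tree V E \<or> quadratic_balls (1 / (4 * (real k + 1)\<^sup>2)) V E"
proof -
  obtain root where "root \<in> V" using connected by (auto simp: connected_graph_def)
  then interpret rooted_graph V E root by unfold_locales
  show ?thesis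
  proof (cases "\<exists>D. \<forall>x y. same_cluster x y \<longrightarrow> d x y \<le> D")
    case True
    then obtain D where "\<And>x y. same_cluster x y \<Longrightarrow> d x y \<le> D" by auto
    from quasi_isometry_rep[OF this] is_tree_cluster_graph have "quasi_isometric_to_tree V E"
      unfolding quasi_isometric_to_tree_def quasi_isometric_def by (intro exI conjI)
    then show ?thesis ..
  next
    case False
    have "\<exists>v\<in>V. infinite (graph_ball V E v r) \<or>
        1 / (4 * (real k + 1)\<^sup>2) * (real r)\<^sup>2 \<le> real (card (graph_ball V E v r))" for r
    proof -
      \<comment> \<open>The bound \<open>6 * r + 2\<close> makes both halves of the geodesic longer
        than \<open>3 * r\<close>, as \<open>geodesic_to_root_avoids\<close> requires.\<close>
      from False obtain x y where xy: "same_cluster x y" "6 * r + 2 < d x y"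
        by (meson not_le)
      then have V: "x \<in> V" "y \<in> V" and lev: "lev x = lev y" by (auto simp: same_cluster_def)
      define N t where "N = d x y" and "t = N div 2"
      obtain g where g: "g 0 = x" "g N = y" "\<And>i. i < N \<Longrightarrow> (g i, g (Suc i)) \<in> adj E"
        "\<And>i. i \<le> N \<Longrightarrow> g i \<in> V" "\<And>i j. i \<le> j \<Longrightarrow> j \<le> N \<Longrightarrow> d (g i) (g j) = j - i"
        unfolding N_def using obtain_geodesic[OF V] by blast
      have t: "3 * r < t" "3 * r < N - t" "t \<le> N" using xy(2) by (auto simp: t_def N_def)
      define m where "m = g t"
      have mV: "m \<in> V" using g(4) t by (simp add: m_def)
      have far: "3 * r < d m x" "3 * r < d m y"
        using g(5)[of 0 t] g(5)[of t N] g(1,2) t d_commute[OF mV V(1)] by (auto simp: m_def)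
      let ?R = "Restr (adj E) {v. r \<le> d m v}"
      have "(y, x) \<in> ?R\<^sup>*"
      \<comment> \<open>If a vertex closer than \<open>r\<close> to \<open>m\<close> has at least
        the level of \<open>x\<close>, then \<open>x\<close> and \<open>y\<close> are at most
        \<open>r\<close> levels above \<open>m\<close> and are joined through the root. Otherwise
        the walk that puts them into one cluster avoids the ball.\<close>
      proof (cases "\<exists>p\<in>V. lev x \<le> lev p \<and> d m p < r")
        case True
        then obtain p where p: "p \<in> V" "lev x \<le> lev p" "d m p < r" by blast
        then have "lev x \<le> lev m + r" using d_triangle[OF root mV p(1)] by linarith
        then have "(root, x) \<in> ?R\<^sup>*" "(root, y) \<in> ?R\<^sup>*"
          using geodesic_to_root_avoids mV V far lev by auto
        then show ?thesis using rtrancl_Restr_sym rtrancl_trans by metis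
      next
        case False
        then have "Restr (adj E) {v. lev x \<le> lev v} \<subseteq> ?R" using adjD by (fastforce simp: not_less)
        then have "(x, y) \<in> ?R\<^sup>*" using xy(1) rtrancl_mono unfolding same_cluster_def by blast
        then show ?thesis by (rule rtrancl_Restr_sym)
      qed
      then have "(g N, g 0) \<in> (Restr (adj E) {v. r \<le> d (g t) v})\<^sup>*" using g by (simp add: m_def)
      then have "finite (graph_ball V E m r) \<Longrightarrow>
          (real r)\<^sup>2 / (4 * (real k + 1)\<^sup>2) \<le> real (card (graph_ball V E m r))"
        unfolding m_def using t by (intro card_ball_ge[of N g, OF g(3-5)]) auto
      then show ?thesis using mV by auto
    qed
    then show ?thesis by (simp add: quadratic_balls_def)
  qed
qed

section \<open>Finite graphs, and countability from finite balls\<close>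

lemma (in conn_graph) quasi_isometric_to_tree_if_finite:
  assumes "finite V"
  shows "quasi_isometric_to_tree V E"
proof -
  obtain root where "root \<in> V" using connected by (auto simp: connected_graph_def)
  then interpret rooted_graph V E root by unfold_locales
  have "d x y \<le> Max ((\<lambda>(x, y). d x y) ` (V \<times> V))" if "same_cluster x y" for x y
    using that assms by (intro Max_ge) (auto simp: same_cluster_def)
  from quasi_isometry_rep[OF this] is_tree_cluster_graph show ?thesis
    unfolding quasi_isometric_to_tree_def quasi_isometric_def by (intro exI conjI)
qed

text \<open>A ball of radius at least 1 contains the neighbours of its centre, so degrees are finite
  and walks of each length reach finitely many vertices.\<close>

lemma (in conn_graph) countable_if_finite_balls:
  assumes fin: "\<And>v. v \<in> V \<Longrightarrow> finite (graph_ball V E v r)" and "r \<noteq> 0"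
  shows "countable V"
proof -
  obtain v where v: "v \<in> V" using connected by (auto simp: connected_graph_def)
  have "finite {w. (v, w) \<in> adj E ^^ n}" for n
  proof (induction n)
    case (Suc n)
    have "{w. (v, w) \<in> adj E ^^ Suc n} \<subseteq> (\<Union>u\<in>{w. (v, w) \<in> adj E ^^ n}. {w. (u, w) \<in> adj E})"
      by auto
    moreover have "finite {w. (u, w) \<in> adj E}" for u
    proof (cases "u \<in> V")
      case True
      have "{w. (u, w) \<in> adj E} \<subseteq> graph_ball V E u r"
        using d_adj adjD \<open>r \<noteq> 0\<close> by (fastforce simp: graph_ball_def)
      then show ?thesis using fin[OF True] finite_subset by blast
    next
      case False
      then have "{w. (u, w) \<in> adj E} = {}" using adjD by blast
      then show ?thesis by simp
    qed
    ultimately show ?case using Suc finite_subset by blast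
  qed simp
  then have "countable (\<Union>n. {w. (v, w) \<in> adj E ^^ n})" by (simp add: countable_finite)
  moreover have "V \<subseteq> (\<Union>n. {w. (v, w) \<in> adj E ^^ n})" using relpow_d[OF v] by blast
  ultimately show ?thesis using countable_subset by blast
qed

section \<open>Invariance under isomorphism\<close>

text \<open>Injectivity on the whole type carries over to edges and edge sets without side
  conditions; the enumeration of a countably infinite set has it.\<close>

locale graph_image =
  fixes h :: "'a \<Rightarrow> 'b"
  assumes inj: "inj h"
begin

lemma inj_image: "inj ((`) h)"
  by (rule injI) (simp add: inj_image_eq_iff[OF inj])

lemma image_edge_iff: "{h u, h v} \<in> (`) h ` E \<longleftrightarrow> {u, v} \<in> E"
  using inj_image_mem_iff[OF inj_image, of "{u, v}" E] by simp

lemma inj_on: "inj_on h A"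
  using inj by (rule inj_on_subset) simp

lemma graph_path_map:
  "graph_path (h ` V) ((`) h ` E) (h x) (map h xs) (h y) \<longleftrightarrow> graph_path V E x xs y"
proof (cases "xs = []")
  case False
  then show ?thesis
    unfolding graph_path_def
    by (simp add: hd_map last_map distinct_map inj_on successively_map image_edge_iff
        inj_image_subset_iff[OF inj] inj_eq[OF inj])
qed (simp add: graph_path_def)

lemma list_in_image:
  assumes "set ys \<subseteq> h ` V"
  obtains xs where "ys = map h xs"
proof -
  have "\<exists>xs. ys = map h xs" unfolding ex_map_conv using assms by blast
  with that show ?thesis by blast
qed

lemma graph_path_image_ex:
  "(\<exists>ys. graph_path (h ` V) ((`) h ` E) (h x) ys (h y) \<and> length ys = n) \<longleftrightarrow>
    (\<exists>xs. graph_path V E x xs y \<and> length xs = n)"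
proof
  assume "\<exists>ys. graph_path (h ` V) ((`) h ` E) (h x) ys (h y) \<and> length ys = n"
  then obtain ys where ys: "graph_path (h ` V) ((`) h ` E) (h x) ys (h y)" "length ys = n" by blast
  from ys(1) have "set ys \<subseteq> h ` V" by (simp add: graph_path_def)
  then obtain xs where "ys = map h xs" by (rule list_in_image)
  with ys show "\<exists>xs. graph_path V E x xs y \<and> length xs = n" by (auto simp: graph_path_map)
next
  assume "\<exists>xs. graph_path V E x xs y \<and> length xs = n"
  then obtain xs where "graph_path V E x xs y" "length xs = n" by blast
  then show "\<exists>ys. graph_path (h ` V) ((`) h ` E) (h x) ys (h y) \<and> length ys = n"
    by (intro exI[of _ "map h xs"]) (simp add: graph_path_map)
qed

lemma graph_dist_image: "graph_dist (h ` V) ((`) h ` E) (h x) (h y) = graph_dist V E x y"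
  unfolding graph_dist_def graph_path_image_ex ..

lemma graph_ball_image: "graph_ball (h ` V) ((`) h ` E) (h v) r = h ` graph_ball V E v r"
  by (auto simp: graph_ball_def graph_dist_image)

lemma simple_graph_image: "simple_graph (h ` V) ((`) h ` E) \<longleftrightarrow> simple_graph V E"
proof -
  have "h ` e = {h x, h y} \<longleftrightarrow> e = {x, y}" for e x y
    using inj_image_eq_iff[OF inj, of e "{x, y}"] by simp
  then show ?thesis by (simp add: simple_graph_def inj_eq[OF inj])
qed

lemma connected_graph_image: "connected_graph (h ` V) ((`) h ` E) \<longleftrightarrow> connected_graph V E"
proof -
  have "(\<exists>ys. graph_path (h ` V) ((`) h ` E) (h x) ys (h y)) \<longleftrightarrow> (\<exists>xs. graph_path V E x xs y)" for x y
    using graph_path_image_ex[of V E x y] by blast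
  then show ?thesis by (simp add: connected_graph_def simple_graph_image)
qed

lemma cycle_edges_map: "cycle_edges (map h C) = (`) h ` cycle_edges C"
proof -
  have "Suc i mod length C < length C" if "i < length C" for i
    using that by (intro mod_less_divisor) linarith
  then have "(\<lambda>i. {map h C ! i, map h C ! (Suc i mod length (map h C))}) ` {..<length (map h C)} =
      (\<lambda>i. h ` {C ! i, C ! (Suc i mod length C)}) ` {..<length C}"
    by (intro image_cong) auto
  then show ?thesis by (simp only: cycle_edges_eq_image image_image)
qed

lemma graph_cycle_map: "graph_cycle (h ` V) ((`) h ` E) (map h C) \<longleftrightarrow> graph_cycle V E C"
  by (simp add: graph_cycle_def distinct_map inj_on cycle_edges_map inj_image_subset_iff[OF inj]
      inj_image_subset_iff[OF inj_image])

lemma graph_cycle_imageE: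
  assumes "graph_cycle (h ` V) ((`) h ` E) C'"
  obtains C where "C' = map h C" "graph_cycle V E C"
proof -
  from assms have "set C' \<subseteq> h ` V" by (simp add: graph_cycle_def)
  then obtain C where "C' = map h C" by (rule list_in_image)
  with assms that show ?thesis by (simp add: graph_cycle_map)
qed

lemma is_tree_image: "is_tree (h ` V) ((`) h ` E) \<longleftrightarrow> is_tree V E"
  unfolding is_tree_def connected_graph_image using graph_cycle_map graph_cycle_imageE by blast

lemma indicator_cycle_edges_map:
  "indicator (cycle_edges (map h C)) (h ` e) = indicator (cycle_edges C) e"
  unfolding cycle_edges_map indicator_def using inj_image_mem_iff[OF inj_image] by simp

text \<open>Pulling edge functions back along the injection of edges is linear and sends generators
  of the image graph to generators of the original one, so it maps span into span.\<close>

lemma cycle_space_generated_image: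
  assumes gen: "cycle_space_generated_upto k (h ` V) ((`) h ` E)"
  shows "cycle_space_generated_upto k V E"
proof -
  let ?S' = "{indicator (cycle_edges C) :: 'b set \<Rightarrow> bit | C.
    graph_cycle (h ` V) ((`) h ` E) C \<and> length C \<le> k}"
  let ?S = "{indicator (cycle_edges C) :: 'a set \<Rightarrow> bit | C. graph_cycle V E C \<and> length C \<le> k}"
  let ?U = "{f :: 'b set \<Rightarrow> bit. (\<lambda>e. f (h ` e)) \<in> edge_space.span ?S}"
  have "?S' \<subseteq> ?U"
  proof
    fix f assume "f \<in> ?S'"
    then obtain C where C: "f = indicator (cycle_edges (map h C))" "graph_cycle V E C" "length C \<le> k"
      by (auto elim: graph_cycle_imageE)
    then have "(\<lambda>e. f (h ` e)) = indicator (cycle_edges C)"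
      by (simp add: indicator_cycle_edges_map fun_eq_iff)
    also have "\<dots> \<in> edge_space.span ?S" using C by (intro edge_space.span_base) blast
    finally show "f \<in> ?U" by simp
  qed
  moreover have "edge_space.subspace ?U"
  proof (rule edge_space.subspaceI)
    show "0 \<in> ?U" using edge_space.span_zero[of ?S] by (simp add: zero_fun_def)
  next
    fix f g assume "f \<in> ?U" "g \<in> ?U"
    then show "f + g \<in> ?U"
      using edge_space.span_add[of "\<lambda>e. f (h ` e)" ?S "\<lambda>e. g (h ` e)"] by (simp add: plus_fun_def)
  next
    fix c f assume "f \<in> ?U"
    then show "(\<lambda>e. c * f e) \<in> ?U"
      using edge_space.span_scale[of "\<lambda>e. f (h ` e)" ?S c] by simp
  qed
  ultimately have sub: "edge_space.span ?S' \<subseteq> ?U" by (rule edge_space.span_minimal)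
  have "indicator (cycle_edges C) \<in> edge_space.span ?S" if C: "graph_cycle V E C" for C
  proof -
    have "indicator (cycle_edges (map h C)) \<in> cycle_space (h ` V) ((`) h ` E)"
      unfolding cycle_space_def using C graph_cycle_map by (intro edge_space.span_base) blast
    then have "indicator (cycle_edges (map h C)) \<in> ?U"
      using gen sub unfolding cycle_space_generated_upto_def by blast
    moreover have "(\<lambda>e. indicator (cycle_edges (map h C)) (h ` e)) = (indicator (cycle_edges C) :: _ \<Rightarrow> bit)"
      by (simp add: indicator_cycle_edges_map fun_eq_iff)
    ultimately show ?thesis by simp
  qed
  then have "cycle_space V E \<subseteq> edge_space.span ?S"
    unfolding cycle_space_def by (intro edge_space.span_minimal edge_space.subspace_span) blast
  moreover have "edge_space.span ?S \<subseteq> cycle_space V E"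
    unfolding cycle_space_def by (intro edge_space.span_mono) blast
  ultimately show ?thesis unfolding cycle_space_generated_upto_def by (rule subset_antisym)
qed

lemma quadratic_balls_image:
  assumes "quadratic_balls c V E"
  shows "quadratic_balls c (h ` V) ((`) h ` E)"
  using assms unfolding quadratic_balls_def
  by (simp add: graph_ball_image card_image inj_on finite_image_iff)

text \<open>Conjugation with \<open>h\<close> keeps both constants; \<open>inv h\<close> is
  evaluated only on the image of \<open>V\<close>.\<close>

lemma quasi_isometry_image:
  assumes "quasi_isometry V E T F f"
  shows "quasi_isometry (h ` V) ((`) h ` E) (h ` T) ((`) h ` F) (\<lambda>x. h (f (inv h x)))"
  using assms unfolding quasi_isometry_def
  by (simp add: graph_dist_image inv_f_f[OF inj] image_subset_iff)

lemma quasi_isometric_to_tree_image: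
  assumes "quasi_isometric_to_tree V E"
  shows "quasi_isometric_to_tree (h ` V) ((`) h ` E)"
proof -
  obtain T F f where "is_tree (T :: 'a set) F" "quasi_isometry V E T F f"
    using assms unfolding quasi_isometric_to_tree_def quasi_isometric_def by blast
  then have "is_tree (h ` T) ((`) h ` F)"
      "quasi_isometry (h ` V) ((`) h ` E) (h ` T) ((`) h ` F) (\<lambda>x. h (f (inv h x)))"
    by (simp_all only: is_tree_image quasi_isometry_image)
  then show ?thesis unfolding quasi_isometric_to_tree_def quasi_isometric_def by (intro exI conjI)
qed

end

section \<open>The constant, and the transfer from graphs on \<open>nat\<close> to all types\<close>

lemma growth_const_spec:
  "growth_const k > 0 \<and>
    (\<forall>(V :: nat set) E. connected_graph V E \<longrightarrow> cycle_space_generated_upto k V E \<longrightarrow>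
       quasi_isometric_to_tree V E \<or> quadratic_balls (growth_const k) V E)"
  unfolding growth_const_def
proof (rule someI_ex, intro exI conjI allI impI)
  \<comment> \<open>The explicit constant shows only that a choice exists; afterwards
    \<open>growth_const k\<close> is known through its property on \<open>nat\<close> alone.\<close>
  show "0 < 1 / (4 * (real k + 1)\<^sup>2)" by simp
next
  fix V :: "nat set" and E
  assume "connected_graph V E" "cycle_space_generated_upto k V E"
  then interpret short_cycles_graph V E k by unfold_locales
  show "quasi_isometric_to_tree V E \<or> quadratic_balls (1 / (4 * (real k + 1)\<^sup>2)) V E"
    by (rule quasi_isometric_to_tree_or_quadratic_balls)
qed

theorem theorem1p3:
  fixes k :: nat
  shows "growth_const k > 0 \<and>
    (\<forall>(V :: 'a set) E. connected_graph V E \<longrightarrow> cycle_space_generated_upto k V E \<longrightarrow>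
       quasi_isometric_to_tree V E \<or> quadratic_balls (growth_const k) V E)"
proof (intro conjI allI impI)
  show "growth_const k > 0" using growth_const_spec by blast
next
  fix V :: "'a set" and E
  assume conn: "connected_graph V E" and gen: "cycle_space_generated_upto k V E"
  interpret conn_graph V E by unfold_locales (rule conn)
  show "quasi_isometric_to_tree V E \<or> quadratic_balls (growth_const k) V E"
  \<comment> \<open>Finite graphs are split off because enumerating \<open>V\<close> by all natural
    numbers requires \<open>V\<close> to be infinite.\<close>
  proof (cases "finite V \<or> quadratic_balls (growth_const k) V E")
    case True
    then show ?thesis using quasi_isometric_to_tree_if_finite by blast
  next
    case False
    then obtain r where r: "\<And>v. v \<in> V \<Longrightarrow> finite (graph_ball V E v r) \<and>
        real (card (graph_ball V E v r)) < growth_const k * (real r)\<^sup>2"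
      unfolding quadratic_balls_def by (auto simp: not_le)
    obtain v where "v \<in> V" using conn by (auto simp: connected_graph_def)
    \<comment> \<open>For \<open>r = 0\<close> the strict bound would make a cardinality
      negative.\<close>
    then have "r \<noteq> 0" using r[of v] by (intro notI) auto
    then have "countable V" using r countable_if_finite_balls by blast
    then have bij: "bij_betw (from_nat_into V) UNIV V"
      using False by (intro bij_betw_from_nat_into) auto
    define h where "h = from_nat_into V"
    have "inj h" "h ` UNIV = V" using bij by (auto simp: h_def bij_betw_def)
    interpret graph_image h by unfold_locales (rule \<open>inj h\<close>)
    \<comment> \<open>The edges are pulled back along the enumeration to an isomorphic graph on
      \<open>nat\<close>; either alternative found there is carried back.\<close>
    define E' where "E' = {e. h ` e \<in> E}"
    have "e \<subseteq> range h" if "e \<in> E" for e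
      using that simple \<open>h ` UNIV = V\<close> by (auto simp: simple_graph_def)
    then have E: "(`) h ` E' = E"
      unfolding E'_def subset_image_iff by (fastforce simp: image_iff)
    have "connected_graph UNIV E'" "cycle_space_generated_upto k UNIV E'"
      using conn gen connected_graph_image[of UNIV E'] cycle_space_generated_image[of k UNIV E']
      unfolding E \<open>h ` UNIV = V\<close> by auto
    then have "quasi_isometric_to_tree UNIV E' \<or> quadratic_balls (growth_const k) UNIV E'"
      using growth_const_spec by blast
    then show ?thesis
      using quasi_isometric_to_tree_image[of UNIV E'] quadratic_balls_image[of _ UNIV E']
      unfolding E \<open>h ` UNIV = V\<close> by blast
  qed
qed

end
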